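(* Let $r \ge 2$ and $n \ge 1$ be integers. Let $E_1, \ldots, E_{rn-r+1}$ be (not necessarily distinct) sets of edges of an $r$-partite hypergraph such that $\nu^*(E_i) \ge n$ for every $i = 1, \ldots, rn-r+1$. Then the family $E_1,\ldots,E_{rn-r+1}$ has a rainbow fractional matching of size $n$.
   Context: A hypergraph is $r$-partite if its vertex set has a partition $A_1,\ldots,A_r$ such that every edge consists of exactly one vertex from each $A_i$. For a set $E$ of edges, a fractional matching for $E$ is a function $f\colon E \to \mathbb{R}_{\ge 0}$ such that $\sum_{e \in E,\, e \ni v} f(e) \le 1$ for every vertex $v$; its size is $\sum_{e\in E} f(e)$. The fractional matching number $\nu^*(E)$ is the maximum size of a fractional matching for $E$. Given a family $E_1,\ldots,E_m$ of sets of edges, a rainbow fractional matching of size $n$ is a set of edges $\{e_1,\ldots,e_k\}$ with $e_j \in E_{\sigma(j)}$ for $j=1,\ldots,k$, where $\sigma(1),\ldots,\sigma(k)$ are distinct indices, together with a fractional matching $f\colon\{e_1,\ldots,e_k\}\to\mathbb{R}_{\ge 0}$ of size $n$. *)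

theory Defs
  imports "HOL-Analysis.Analysis"
begin

definition r_partite :: "nat \<Rightarrow> 'a set \<Rightarrow> 'a set set \<Rightarrow> bool" where
  "r_partite r V H \<longleftrightarrow>
     (\<exists>A :: nat \<Rightarrow> 'a set.
        disjoint_family_on A {1..r} \<and> (\<Union>i\<in>{1..r}. A i) = V \<and>
        (\<forall>e\<in>H. e \<subseteq> V \<and> (\<forall>i\<in>{1..r}. card (e \<inter> A i) = 1)))"

text \<open>
  Only the values on \<open>E\<close> matter. The bound is required for every \<open>v\<close> of the ambient type, which
  is the same as for every vertex, since the sum is empty when \<open>v\<close> lies in no edge. The sums are
  meaningful only for finite \<open>E\<close>.
\<close>
definition fractional_matching :: "'a set set \<Rightarrow> ('a set \<Rightarrow> real) \<Rightarrow> bool" where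
  "fractional_matching E f \<longleftrightarrow>
     (\<forall>e\<in>E. f e \<ge> 0) \<and> (\<forall>v. (\<Sum>e | e \<in> E \<and> v \<in> e. f e) \<le> 1)"

definition fm_size :: "'a set set \<Rightarrow> ('a set \<Rightarrow> real) \<Rightarrow> real" where
  "fm_size E f = (\<Sum>e\<in>E. f e)"

definition fractional_matching_number :: "'a set set \<Rightarrow> real" where
  "fractional_matching_number E = (GREATEST s. \<exists>f. fractional_matching E f \<and> s = fm_size E f)"

text \<open>
  The edge set \<open>e ` {1..k}\<close> may have fewer than \<open>k\<close> elements, as the \<open>e j\<close> are not required
  to be distinct; the indices \<open>\<sigma> j\<close> are. Each edge is weighted once.
\<close>
definition rainbow_fractional_matching ::
    "nat \<Rightarrow> (nat \<Rightarrow> 'a set set) \<Rightarrow> real \<Rightarrow> bool" where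
  "rainbow_fractional_matching m E s \<longleftrightarrow>
     (\<exists>(k::nat) (e :: nat \<Rightarrow> 'a set) (\<sigma> :: nat \<Rightarrow> nat) f.
        \<sigma> ` {1..k} \<subseteq> {1..m} \<and> inj_on \<sigma> {1..k} \<and> (\<forall>j\<in>{1..k}. e j \<in> E (\<sigma> j)) \<and>
        fractional_matching (e ` {1..k}) f \<and> fm_size (e ` {1..k}) f = s)"

text \<open>The maximum in the definition of the fractional matching number is attained.\<close>

lemma fractional_matching_number_attained:
  fixes E :: "'a set set"
  assumes fin: "finite E" and ne: "{} \<notin> E"
  obtains f where "fractional_matching E f" "fm_size E f = fractional_matching_number E"
    "\<And>g. fractional_matching E g \<Longrightarrow> fm_size E g \<le> fractional_matching_number E"
proof -
  define P where "P = (PiE UNIV (\<lambda>e. if e \<in> E then {0..1} else {0}) :: ('a set \<Rightarrow> real) set)"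
  define C where "C = (\<Inter>v. {f :: 'a set \<Rightarrow> real. (\<Sum>e | e \<in> E \<and> v \<in> e. f e) \<le> 1})"
  have "compactin (product_topology (\<lambda>_. euclidean) UNIV) P"
    unfolding P_def by (subst compactin_PiE) auto
  then have "compact P"
    by (simp add: euclidean_product_topology)
  have cont: "continuous_on UNIV (\<lambda>f :: 'a set \<Rightarrow> real. \<Sum>e\<in>S. f e)" for S
    by (intro continuous_on_sum continuous_on_product_coordinates)
  have "closed C"
    unfolding C_def by (intro closed_INT ballI closed_Collect_le cont continuous_on_const)
  with \<open>compact P\<close> have "compact (P \<inter> C)"
    by (rule compact_Int_closed)
  moreover have "(\<lambda>_. 0) \<in> P \<inter> C"
    by (auto simp: P_def C_def)
  ultimately obtain f where f: "f \<in> P \<inter> C" "\<And>g. g \<in> P \<inter> C \<Longrightarrow> fm_size E g \<le> fm_size E f"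
    unfolding fm_size_def
    using continuous_attains_sup[of "P \<inter> C" "\<lambda>f. \<Sum>e\<in>E. f e"] continuous_on_subset[OF cont]
    by blast
  have fm: "fractional_matching E f"
    unfolding fractional_matching_def
  proof (intro conjI ballI allI)
    fix e assume "e \<in> E"
    have "f e \<in> (if e \<in> E then {0..1} else {0})"
      using f(1) unfolding P_def by (blast intro: PiE_mem)
    with \<open>e \<in> E\<close> show "f e \<ge> 0"
      by simp
  qed (use f(1) in \<open>auto simp: C_def\<close>)
  have le: "fm_size E g \<le> fm_size E f" if g: "fractional_matching E g" for g
  proof -
    define h where "h = (\<lambda>e. if e \<in> E then g e else 0)"
    have "g e \<le> 1" if "e \<in> E" for e
    proof -
      obtain v where "v \<in> e"
        using \<open>e \<in> E\<close> ne by (metis ex_in_conv)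
      have "g e \<le> (\<Sum>e | e \<in> E \<and> v \<in> e. g e)"
        using g fin \<open>e \<in> E\<close> \<open>v \<in> e\<close>
        by (intro member_le_sum) (auto simp: fractional_matching_def)
      also have "\<dots> \<le> 1"
        using g by (simp add: fractional_matching_def)
      finally show ?thesis .
    qed
    then have "h \<in> P"
      using g by (auto simp: h_def P_def fractional_matching_def)
    moreover have "h \<in> C"
      using g by (auto simp: h_def C_def fractional_matching_def)
    ultimately have "fm_size E h \<le> fm_size E f"
      using f(2) by blast
    moreover have "fm_size E h = fm_size E g"
      by (simp add: fm_size_def h_def)
    ultimately show ?thesis by simp
  qed
  have "fractional_matching_number E = fm_size E f"
    unfolding fractional_matching_number_def
    by (rule Greatest_equality) (use fm le in auto)
  with fm le show ?thesis
    using that by metis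
qed

end

theory Submission
  imports Defs
begin

text \<open>
  The argument is a nearest-point proof in the style of Barany's colourful Caratheodory theorem.
  Among all nonnegative weights \<open>f\<close> with rainbow support, minimise the squared distance (the
  \<open>defect\<close>) of \<open>f\<close> from being a fractional matching of size \<open>n\<close>. The excess loads
  \<open>w v = max 0 (load v - 1)\<close> and the missing size \<open>t = n - \<Sum>f\<close> are the coordinates of the
  difference vector. If the defect is positive, optimality makes \<open>w / t\<close> a fractional cover of the
  support of \<open>f\<close>, tight on that support and of total weight less than \<open>n\<close>. A linear dependency
  argument allows one to assume that the support has at most as many edges as there are vertices of
  load at least \<open>1\<close>; since each part carries total load \<open>\<Sum>f < n\<close>, there are at most
  \<open>r (n - 1)\<close> such vertices. So some colour is unused, and as its edge set has a fractional matching
  of size \<open>n\<close>, it contains an edge not covered by \<open>w / t\<close>. Adding a little of this edge to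
  \<open>f\<close> decreases the defect.
\<close>

section \<open>Linear dependencies and the ratio test\<close>

text \<open>Gaussian elimination, one coordinate at a time. The vectors are indexed by
  \<open>J\<close> rather than collected in a set, because distinct edges may have equal incidence
  vectors once restricted to a few vertices.\<close>

lemma linear_dependency:
  fixes a :: "'j \<Rightarrow> 'k \<Rightarrow> real"
  assumes "finite K" "finite J" "card K < card J"
  obtains c where "\<exists>j\<in>J. c j \<noteq> 0" "\<forall>k\<in>K. (\<Sum>j\<in>J. c j * a j k) = 0"
proof -
  have "\<exists>c. (\<exists>j\<in>J. c j \<noteq> 0) \<and> (\<forall>k\<in>K. (\<Sum>j\<in>J. c j * a j k) = 0)"
    using assms
  proof (induction K arbitrary: J a rule: finite_induct)
    case empty
    then have "J \<noteq> {}"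
      by auto
    then show ?case
      by (intro exI[of _ "\<lambda>_. 1"]) auto
  next
    case (insert k K)
    show ?case
    proof (cases "\<forall>j\<in>J. a j k = 0")
      case True
      have "card K < card J"
        using insert.prems insert.hyps by simp
      from insert.IH[OF insert.prems(1) this, of a] obtain c where
        c: "\<exists>j\<in>J. c j \<noteq> 0" "\<forall>k\<in>K. (\<Sum>j\<in>J. c j * a j k) = 0"
        by (elim exE conjE)
      with True have "(\<Sum>j\<in>J. c j * a j k) = 0"
        by simp
      with c show ?thesis
        by blast
    next
      case False
      then obtain i where i: "i \<in> J" "a i k \<noteq> 0"
        by blast
      define J' where "J' = J - {i}"
      have J: "J = insert i J'" "i \<notin> J'" "finite J'"
        using i insert.prems by (auto simp: J'_def)
      have "card K < card J'"
        using insert.prems insert.hyps J by simp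
      then obtain c where c: "\<exists>j\<in>J'. c j \<noteq> 0"
        "\<And>l. l \<in> K \<Longrightarrow> (\<Sum>j\<in>J'. c j * (a j l - a j k / a i k * a i l)) = 0"
        using insert.IH[of J' "\<lambda>j l. a j l - a j k / a i k * a i l"] J(3) by blast
      \<comment> \<open>The coefficient of \<open>i\<close> is chosen to cancel coordinate
        \<open>k\<close>; in the other coordinates it yields exactly the eliminated system solved by
        \<open>c\<close>.\<close>
      define d where "d = c(i := - (\<Sum>j\<in>J'. c j * a j k) / a i k)"
      have d: "(\<Sum>j\<in>J. d j * a j l)
        = (\<Sum>j\<in>J'. c j * a j l) - (\<Sum>j\<in>J'. c j * a j k) / a i k * a i l" for l
      proof -
        have "(\<Sum>j\<in>J'. d j * a j l) = (\<Sum>j\<in>J'. c j * a j l)"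
          using J(2) by (intro sum.cong) (auto simp: d_def)
        then show ?thesis
          using J by (simp add: d_def)
      qed
      have "(\<Sum>j\<in>J. d j * a j l) = 0" if "l \<in> K" for l
        using c(2)[OF that] unfolding d
        by (simp add: algebra_simps sum_subtractf sum_distrib_left sum_distrib_right sum_divide_distrib)
      moreover have "(\<Sum>j\<in>J. d j * a j k) = 0"
        unfolding d using i by simp
      moreover have "\<exists>j\<in>J. d j \<noteq> 0"
        using c(1) J by (auto simp: d_def)
      ultimately show ?thesis
        by blast
    qed
  qed
  then show ?thesis
    using that by blast
qed

text \<open>The ratio test of the simplex method: \<open>u\<close> is the least value at which a
  decreasing coordinate reaches \<open>0\<close>.\<close>

lemma shift_to_boundary:
  fixes x c :: "'j \<Rightarrow> real"
  assumes "finite J" "\<And>j. j \<in> J \<Longrightarrow> x j > 0" "\<exists>j\<in>J. c j < 0"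
  obtains u where "u > 0" "\<And>j. j \<in> J \<Longrightarrow> x j + u * c j \<ge> 0" "\<exists>j\<in>J. x j + u * c j = 0"
proof -
  define N where "N = {j \<in> J. c j < 0}"
  define u where "u = Min ((\<lambda>j. x j / (- c j)) ` N)"
  have N: "finite N" "N \<noteq> {}"
    using assms by (auto simp: N_def)
  have "u \<in> (\<lambda>j. x j / (- c j)) ` N"
    unfolding u_def using N by (intro Min_in) auto
  then obtain i where i: "i \<in> N" "u = x i / (- c i)"
    by blast
  have pos: "u > 0"
    using i assms(2) by (auto simp: N_def divide_pos_neg)
  have "x j + u * c j \<ge> 0" if "j \<in> J" for j
  proof (cases "c j < 0")
    case True
    then have "u \<le> x j / (- c j)"
      unfolding u_def using N that by (intro Min_le) (auto simp: N_def)
    with True show ?thesis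
      by (simp add: field_simps)
  next
    case False
    with pos assms(2)[OF that] show ?thesis
      by (simp add: less_imp_le)
  qed
  moreover have "i \<in> J" "x i + u * c i = 0"
    using i by (auto simp: N_def)
  ultimately show ?thesis
    using that pos by blast
qed

section \<open>Loads, the defect and the existence of a minimiser\<close>

definition load :: "'a set set \<Rightarrow> ('a set \<Rightarrow> real) \<Rightarrow> 'a \<Rightarrow> real" where
  "load F f v = (\<Sum>e | e \<in> F \<and> v \<in> e. f e)"

text \<open>Squaring makes the positive part differentiable, so that moves along one edge can be
  analysed to first order. Vertices outside \<open>\<Union>F\<close> have load \<open>0\<close> and
  hence no excess.\<close>

definition defect :: "real \<Rightarrow> 'a set set \<Rightarrow> ('a set \<Rightarrow> real) \<Rightarrow> real" where
  "defect s F f = (\<Sum>v\<in>\<Union>F. (max 0 (load F f v - 1))\<^sup>2) + (s - sum f F)\<^sup>2"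

lemma load_add: "load F (\<lambda>e. f e + u * d e) v = load F f v + u * load F d v"
  by (simp add: load_def sum.distrib sum_distrib_left)

lemma load_alt: "finite F \<Longrightarrow> load F f v = (\<Sum>e\<in>F. if v \<in> e then f e else 0)"
  unfolding load_def by (subst sum.inter_filter[symmetric]) auto

lemma load_nonneg: "(\<And>e. e \<in> F \<Longrightarrow> f e \<ge> 0) \<Longrightarrow> load F f v \<ge> 0"
  by (auto simp: load_def intro: sum_nonneg)

text \<open>Double counting of incidences, the exchange behind the duality steps below. Intersecting
  with \<open>U\<close> lets it apply to a single part as well as to all vertices.\<close>

lemma sum_weighted_load:
  fixes w :: "'a \<Rightarrow> real"
  assumes "finite F" "finite U"
  shows "(\<Sum>v\<in>U. w v * load F f v) = (\<Sum>e\<in>F. f e * sum w (e \<inter> U))"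
proof -
  have "(\<Sum>v\<in>U. w v * load F f v) = (\<Sum>v\<in>U. \<Sum>e\<in>F. if v \<in> e then f e * w v else 0)"
    using assms by (simp add: load_alt sum_distrib_left mult.commute if_distrib cong: if_cong)
  also have "\<dots> = (\<Sum>e\<in>F. \<Sum>v\<in>U. if v \<in> e then f e * w v else 0)"
    by (rule sum.swap)
  also have "\<dots> = (\<Sum>e\<in>F. f e * sum w (e \<inter> U))"
  proof (rule sum.cong)
    fix e
    have "(\<Sum>v\<in>U. if v \<in> e then f e * w v else 0) = (\<Sum>v\<in>U \<inter> e. f e * w v)"
      using assms by (simp add: sum.inter_restrict)
    then show "(\<Sum>v\<in>U. if v \<in> e then f e * w v else 0) = f e * sum w (e \<inter> U)"
      by (simp add: sum_distrib_left Int_commute)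
  qed simp
  finally show ?thesis .
qed

lemma continuous_defect: "continuous_on UNIV (defect s F)"
proof -
  have coord: "continuous_on UNIV (\<lambda>f :: 'a set \<Rightarrow> real. \<Sum>e\<in>S. f e)" for S
    by (intro continuous_on_sum continuous_on_product_coordinates)
  then show ?thesis
    unfolding defect_def load_def by (intro continuous_intros coord)
qed

text \<open>Admissible weights are unbounded, so compactness is applied to finitely many boxes, one
  for each \<open>S \<subseteq> F\<close> in \<open>\<I>\<close>. A point of the box of
  \<open>S\<close> may have smaller support, which stays in \<open>\<I>\<close> by
  \<open>down\<close>.\<close>

lemma defect_minimiser:
  fixes F :: "'a set set"
  assumes fin: "finite F" and s: "s \<ge> 0"
    and empty: "{} \<in> \<I>" and down: "\<And>S T. S \<in> \<I> \<Longrightarrow> T \<subseteq> S \<Longrightarrow> T \<in> \<I>"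
  obtains f where "\<And>e. e \<in> F \<Longrightarrow> f e \<ge> 0" "{e \<in> F. f e \<noteq> 0} \<in> \<I>"
    "\<And>g. (\<And>e. e \<in> F \<Longrightarrow> g e \<ge> 0) \<Longrightarrow> {e \<in> F. g e \<noteq> 0} \<in> \<I> \<Longrightarrow> defect s F f \<le> defect s F g"
proof -
  define P where "P S = (PiE UNIV (\<lambda>e. if e \<in> S then {0..2 * s} else {0}) :: ('a set \<Rightarrow> real) set)" for S
  define C where "C = (\<Union>S\<in>\<I> \<inter> Pow F. P S)"
  have mem: "f \<in> P S \<longleftrightarrow> (\<forall>e. if e \<in> S then 0 \<le> f e \<and> f e \<le> 2 * s else f e = 0)" for f S
    unfolding P_def by (auto simp: PiE_iff split: if_splits)
  have "compactin (product_topology (\<lambda>_. euclidean) UNIV) (P S)" for S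
    unfolding P_def by (subst compactin_PiE) auto
  then have "compact (P S)" for S
    by (simp add: euclidean_product_topology)
  then have "compact C"
    unfolding C_def using fin by (intro compact_UN) auto
  moreover have zero: "(\<lambda>_. 0) \<in> C"
    using empty s by (auto simp: C_def mem)
  ultimately obtain f where f: "f \<in> C" "\<And>g. g \<in> C \<Longrightarrow> defect s F f \<le> defect s F g"
    using continuous_attains_inf[of C "defect s F"] continuous_on_subset[OF continuous_defect]
    by blast
  from f(1) obtain S where S: "S \<in> \<I>" "S \<subseteq> F" "f \<in> P S"
    by (auto simp: C_def)
  have "f e \<ge> 0" for e
    using S(3) unfolding mem by (metis order_refl)
  moreover have "{e \<in> F. f e \<noteq> 0} \<subseteq> S"
    using S(3) unfolding mem by (auto split: if_splits)
  then have "{e \<in> F. f e \<noteq> 0} \<in> \<I>"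
    using down S(1) by blast
  moreover have "defect s F f \<le> defect s F g"
    if g: "\<And>e. e \<in> F \<Longrightarrow> g e \<ge> 0" "{e \<in> F. g e \<noteq> 0} \<in> \<I>" for g
  \<comment> \<open>The zero weight has defect \<open>s\<^sup>2\<close>, so only competitors at or
    below this value matter; their total, and hence each of their weights, is at most
    \<open>2 * s\<close>.\<close>
  proof (cases "defect s F g \<le> s\<^sup>2")
    case True
    \<comment> \<open>The boxes demand the value \<open>0\<close> outside \<open>F\<close>, where
      the defect does not look.\<close>
    define h where "h = (\<lambda>e. if e \<in> F then g e else 0)"
    have "(s - sum g F)\<^sup>2 \<le> defect s F g"
      by (simp add: defect_def sum_nonneg)
    with True have "(s - sum g F)\<^sup>2 \<le> s\<^sup>2"
      by simp
    then have "\<bar>s - sum g F\<bar> \<le> s"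
      using s abs_le_square_iff[of "s - sum g F" s] by simp
    then have "sum g F \<le> 2 * s"
      by linarith
    moreover have "g e \<le> sum g F" if "e \<in> F" for e
      using that g fin by (intro member_le_sum) auto
    ultimately have "h \<in> P {e \<in> F. g e \<noteq> 0}"
      using g(1) unfolding mem h_def by fastforce
    with g(2) have "h \<in> C"
      by (auto simp: C_def)
    moreover have "defect s F h = defect s F g"
      by (simp add: defect_def load_def h_def)
    ultimately show ?thesis
      using f(2) by metis
  next
    case False
    have "defect s F (\<lambda>_. 0) = s\<^sup>2"
      by (simp add: defect_def load_def)
    then show ?thesis
      using f(2)[OF zero] False by linarith
  qed
  ultimately show ?thesis
    using that by blast
qed

section \<open>Change of the defect along a single edge\<close>

text \<open>The squared positive part has derivative \<open>2 * max 0 a\<close>, whose slope never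
  exceeds \<open>2\<close>; hence the tangent plus \<open>b\<^sup>2\<close> is an upper
  bound.\<close>

lemma max_add_square_le: "(max 0 (a + b))\<^sup>2 \<le> (max 0 a)\<^sup>2 + 2 * b * max 0 a + (b::real)\<^sup>2"
proof (cases "a \<ge> 0")
  case True
  have "(max 0 (a + b))\<^sup>2 \<le> (a + b)\<^sup>2"
    by (simp add: max_def)
  with True show ?thesis
    by (simp add: power2_sum algebra_simps)
next
  case False
  then have "max 0 (a + b) \<le> \<bar>b\<bar>"
    by simp
  then have "(max 0 (a + b))\<^sup>2 \<le> b\<^sup>2"
    using power_mono[of "max 0 (a + b)" "\<bar>b\<bar>" 2] by simp
  with False show ?thesis
    by simp
qed

lemma small_step_decreases:
  fixes G Q D :: real
  assumes "G < 0" "D > 0"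
  obtains u where "0 < u" "u \<le> D" "u * G + u\<^sup>2 * Q < 0"
proof -
  \<comment> \<open>The second bound gives \<open>u * Q \<le> - G / 2\<close>; the
    \<open>+ 1\<close> keeps the denominator positive when \<open>Q = 0\<close>.\<close>
  define u where "u = min D (- G / (2 * (\<bar>Q\<bar> + 1)))"
  have u: "0 < u" "u \<le> D" "u \<le> - G / (2 * (\<bar>Q\<bar> + 1))"
    using assms by (auto simp: u_def divide_neg_pos)
  have "u * Q \<le> u * (\<bar>Q\<bar> + 1)"
    using u by (intro mult_left_mono) auto
  also have "\<dots> \<le> - G / 2"
    using u(3) by (simp add: field_simps)
  finally have "G + u * Q < 0"
    using assms by linarith
  then have "u * (G + u * Q) < 0"
    using u(1) by (simp add: mult_pos_neg)
  with u show ?thesis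
    using that by (simp add: algebra_simps power2_eq_square)
qed

text \<open>The linear coefficient is the derivative of the defect in the direction of
  \<open>e\<close>. Each of the \<open>card e\<close> vertices and the size term adds at most
  \<open>u\<^sup>2\<close> at second order. The step \<open>u\<close> may have either sign, which
  serves both increase and decrease.\<close>

lemma defect_step_le:
  fixes f :: "'a set \<Rightarrow> real"
  assumes fin: "finite F" "finite (\<Union>F)" and e: "e \<in> F"
  defines "w \<equiv> \<lambda>v. max 0 (load F f v - 1)"
  shows "defect s F (f(e := f e + u))
    \<le> defect s F f + u * (2 * (sum w e - (s - sum f F))) + u\<^sup>2 * (real (card e) + 1)"
proof -
  define d where "d = (\<lambda>x. if x = e then 1 else 0 :: real)"
  have upd: "f(e := f e + u) = (\<lambda>x. f x + u * d x)"
    by (auto simp: d_def)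
  have ld: "load F d v = (if v \<in> e then 1 else 0)" for v
    using fin e by (auto simp: load_def d_def)
  have sub: "\<Union>F \<inter> e = e"
    using e by auto
  have "(\<Sum>v\<in>\<Union>F. (max 0 (load F f v - 1 + u * load F d v))\<^sup>2)
    \<le> (\<Sum>v\<in>\<Union>F. (w v)\<^sup>2 + 2 * (u * load F d v) * w v + (u * load F d v)\<^sup>2)"
    unfolding w_def by (intro sum_mono max_add_square_le)
  also have "\<dots> = (\<Sum>v\<in>\<Union>F. (w v)\<^sup>2) + (\<Sum>v\<in>\<Union>F. if v \<in> e then 2 * u * w v else 0)
      + (\<Sum>v\<in>\<Union>F. if v \<in> e then u\<^sup>2 else 0)"
    by (auto simp: sum.distrib[symmetric] ld intro!: sum.cong)
  also have "\<dots> = (\<Sum>v\<in>\<Union>F. (w v)\<^sup>2) + 2 * u * sum w e + u\<^sup>2 * real (card e)"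
    using fin(2) by (simp add: sum.inter_restrict[symmetric] sub sum_distrib_left)
  finally have A: "(\<Sum>v\<in>\<Union>F. (max 0 (load F f v - 1 + u * load F d v))\<^sup>2)
    \<le> (\<Sum>v\<in>\<Union>F. (w v)\<^sup>2) + 2 * u * sum w e + u\<^sup>2 * real (card e)" .
  have "sum d F = 1"
    using fin e by (simp add: d_def)
  then have S: "(\<Sum>x\<in>F. f x + u * d x) = sum f F + u"
    by (simp add: sum.distrib sum_distrib_left[symmetric])
  have "defect s F (\<lambda>x. f x + u * d x)
    = (\<Sum>v\<in>\<Union>F. (max 0 (load F f v - 1 + u * load F d v))\<^sup>2) + (s - (sum f F + u))\<^sup>2"
    unfolding defect_def load_add S by (simp add: algebra_simps)
  moreover have "defect s F f = (\<Sum>v\<in>\<Union>F. (w v)\<^sup>2) + (s - sum f F)\<^sup>2"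
    by (simp add: defect_def w_def)
  moreover have "(s - (sum f F + u))\<^sup>2 = (s - sum f F)\<^sup>2 - 2 * u * (s - sum f F) + u\<^sup>2"
    by (simp add: power2_eq_square algebra_simps)
  ultimately show ?thesis
    unfolding upd using A by (simp add: algebra_simps)
qed

lemma defect_decreases_up:
  fixes f :: "'a set \<Rightarrow> real"
  assumes "finite F" "finite (\<Union>F)" "e \<in> F"
    and "(\<Sum>v\<in>e. max 0 (load F f v - 1)) < s - sum f F"
  obtains u where "u > 0" "defect s F (f(e := f e + u)) < defect s F f"
proof -
  define G where "G = 2 * ((\<Sum>v\<in>e. max 0 (load F f v - 1)) - (s - sum f F))"
  have "G < 0"
    using assms(4) by (simp add: G_def)
  then obtain u where u: "0 < u" "u * G + u\<^sup>2 * (real (card e) + 1) < 0"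
    using small_step_decreases[of G 1 "real (card e) + 1"] by auto
  with defect_step_le[OF assms(1-3), of s f u] show ?thesis
    using that[of u] by (auto simp: G_def)
qed

lemma defect_decreases_down:
  fixes f :: "'a set \<Rightarrow> real"
  assumes "finite F" "finite (\<Union>F)" "e \<in> F" "f e > 0"
    and "(\<Sum>v\<in>e. max 0 (load F f v - 1)) > s - sum f F"
  obtains u where "u \<le> f e" "defect s F (f(e := f e - u)) < defect s F f"
proof -
  define G where "G = - (2 * ((\<Sum>v\<in>e. max 0 (load F f v - 1)) - (s - sum f F)))"
  have "G < 0"
    using assms(5) by (simp add: G_def)
  then obtain u where u: "0 < u" "u \<le> f e" "u * G + u\<^sup>2 * (real (card e) + 1) < 0"
    using small_step_decreases[of G "f e" "real (card e) + 1"] assms(4) by auto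
  have "defect s F (f(e := f e - u)) \<le> defect s F f + (u * G + u\<^sup>2 * (real (card e) + 1))"
    using defect_step_le[OF assms(1-3), of s f "- u"] by (simp add: G_def algebra_simps)
  with u show ?thesis
    by (intro that[of u]) auto
qed

section \<open>Complementary slackness and reduction of the support\<close>

text \<open>Complementary slackness: double counting and tightness evaluate the sum of
  \<open>w v * load F f v\<close> as \<open>t * sum f F\<close>, while \<open>w v\<close> is either
  \<open>0\<close> or \<open>load F f v - 1\<close>. For \<open>t > 0\<close> the result says that
  \<open>w / t\<close> has total weight \<open>s - defect s F f / t\<close>.\<close>

lemma defect_duality:
  fixes f :: "'a set \<Rightarrow> real" and s :: real
  assumes fin: "finite F" "finite (\<Union>F)"
  defines "w \<equiv> \<lambda>v. max 0 (load F f v - 1)" and "t \<equiv> s - sum f F"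
  assumes slack: "\<And>e. e \<in> F \<Longrightarrow> f e \<noteq> 0 \<Longrightarrow> sum w e = t"
  shows "sum w (\<Union>F) + defect s F f = t * s"
proof -
  have "(\<Sum>v\<in>\<Union>F. w v * load F f v) = (\<Sum>e\<in>F. f e * sum w (e \<inter> \<Union>F))"
    using fin by (rule sum_weighted_load)
  also have "\<dots> = (\<Sum>e\<in>F. f e * t)"
  proof (rule sum.cong)
    fix e assume "e \<in> F"
    then have "e \<inter> \<Union>F = e"
      by auto
    with slack[OF \<open>e \<in> F\<close>] show "f e * sum w (e \<inter> \<Union>F) = f e * t"
      by (cases "f e = 0") auto
  qed simp
  finally have "(\<Sum>v\<in>\<Union>F. w v * load F f v) = t * sum f F"
    by (simp add: sum_distrib_left mult.commute)
  moreover have "w v * load F f v = w v + (w v)\<^sup>2" for v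
    by (simp add: w_def max_def power2_eq_square algebra_simps)
  ultimately have "sum w (\<Union>F) + (\<Sum>v\<in>\<Union>F. (w v)\<^sup>2) = t * sum f F"
    by (simp add: sum.distrib)
  moreover have "defect s F f = (\<Sum>v\<in>\<Union>F. (w v)\<^sup>2) + t\<^sup>2"
    by (simp add: defect_def w_def t_def)
  moreover have "t * s = t * sum f F + t\<^sup>2"
    by (simp add: t_def power2_eq_square algebra_simps)
  ultimately show ?thesis
    by simp
qed

text \<open>
  The weights are moved along a dependency among the incidence vectors of the support, restricted to
  the vertices of load at least \<open>1\<close>. Tightness of \<open>w\<close> forces such a dependency to have total
  weight \<open>0\<close>, so that the defect stays constant until an edge leaves the support or another vertex
  reaches load \<open>1\<close>.
\<close>

lemma reduce_support:
  fixes f :: "'a set \<Rightarrow> real"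
  assumes fin: "finite F" "finite (\<Union>F)" and nonneg: "\<And>e. e \<in> F \<Longrightarrow> f e \<ge> 0"
  defines "w \<equiv> \<lambda>v. max 0 (load F f v - 1)"
  assumes slack: "\<And>e. e \<in> F \<Longrightarrow> f e \<noteq> 0 \<Longrightarrow> sum w e = t" and t: "t \<noteq> 0"
    and card: "card {v \<in> \<Union>F. load F f v \<ge> 1} < card {e \<in> F. f e \<noteq> 0}"
  obtains g where "\<forall>e\<in>F. g e \<ge> 0" "{e \<in> F. g e \<noteq> 0} \<subseteq> {e \<in> F. f e \<noteq> 0}"
    "defect s F g = defect s F f"
    "card {e \<in> F. g e \<noteq> 0} + card {v \<in> \<Union>F. load F g v < 1}
      < card {e \<in> F. f e \<noteq> 0} + card {v \<in> \<Union>F. load F f v < 1}"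
proof -
  define S T L where "S = {e \<in> F. f e \<noteq> 0}" and "T = {v \<in> \<Union>F. load F f v \<ge> 1}"
    and "L = {v \<in> \<Union>F. load F f v < 1}"
  have fins: "finite S" "finite T" "finite L"
    using finite_subset[OF _ fin(1), of S] finite_subset[OF _ fin(2), of T]
      finite_subset[OF _ fin(2), of L] by (auto simp: S_def T_def L_def)
  have "card T < card S"
    using card by (simp only: S_def T_def)
  then obtain c' :: "'a set \<Rightarrow> real" where c': "\<exists>e\<in>S. c' e \<noteq> 0"
    "\<forall>v\<in>T. (\<Sum>e\<in>S. c' e * (if v \<in> e then 1 else 0)) = 0"
    by (rule linear_dependency[OF fins(2,1), of "\<lambda>e v. if v \<in> e then 1 else 0"])
  define c where "c = (\<lambda>e. if e \<in> S then c' e else 0)"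
  have "S \<subseteq> F"
    by (auto simp: S_def)
  have load_c: "load F c v = 0" if "v \<in> T" for v
  proof -
    have "load F c v = (\<Sum>e\<in>F. if v \<in> e then c e else 0)"
      by (rule load_alt[OF fin(1)])
    also have "\<dots> = (\<Sum>e\<in>S. if v \<in> e then c e else 0)"
      using fin(1) \<open>S \<subseteq> F\<close> by (intro sum.mono_neutral_right) (auto simp: c_def)
    also have "\<dots> = (\<Sum>e\<in>S. c' e * (if v \<in> e then 1 else 0))"
      by (intro sum.cong) (auto simp: c_def)
    finally show ?thesis
      using c'(2) that by simp
  qed
  \<comment> \<open>\<open>w\<close> vanishes off \<open>T\<close> and the load of \<open>c\<close>
    vanishes on \<open>T\<close>. Counting the same sum over edges gives \<open>t * sum c F\<close>,
    so the dependency has total \<open>0\<close>.\<close>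
  have "(\<Sum>v\<in>\<Union>F. w v * load F c v) = 0"
  proof (rule sum.neutral, intro ballI)
    fix v assume "v \<in> \<Union>F"
    show "w v * load F c v = 0"
      using load_c[of v] \<open>v \<in> \<Union>F\<close> by (cases "v \<in> T") (auto simp: T_def w_def)
  qed
  moreover have "(\<Sum>v\<in>\<Union>F. w v * load F c v) = (\<Sum>e\<in>F. c e * sum w (e \<inter> \<Union>F))"
    using fin by (rule sum_weighted_load)
  moreover have "(\<Sum>e\<in>F. c e * sum w (e \<inter> \<Union>F)) = (\<Sum>e\<in>F. c e * t)"
  proof (rule sum.cong)
    fix e assume "e \<in> F"
    then have "e \<inter> \<Union>F = e"
      by auto
    with slack[OF \<open>e \<in> F\<close>] show "c e * sum w (e \<inter> \<Union>F) = c e * t"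
      by (auto simp: c_def S_def)
  qed simp
  ultimately have "sum c F = 0"
    using t by (simp add: sum_distrib_right[symmetric])
  \<comment> \<open>A nonzero \<open>c\<close> of total \<open>0\<close> has a negative entry, which
    guarantees that the move below reaches a boundary.\<close>
  have neg: "\<exists>e\<in>S. c e < 0"
  proof (rule ccontr)
    assume "\<not> ?thesis"
    then have "\<And>e. e \<in> F \<Longrightarrow> c e \<ge> 0"
      by (auto simp: c_def not_less)
    with \<open>sum c F = 0\<close> have "\<forall>e\<in>F. c e = 0"
      using sum_nonneg_eq_0_iff[OF fin(1), of c] by simp
    moreover from c'(1) obtain e where "e \<in> S" "c' e \<noteq> 0"
      by blast
    ultimately show False
      using \<open>S \<subseteq> F\<close> by (force simp: c_def)
  qed
  \<comment> \<open>The disjoint sum lets one ratio test handle both events: a weight on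
    \<open>S\<close> falling to \<open>0\<close> and a load on \<open>L\<close> rising to
    \<open>1\<close>. All these slacks are positive at the start.\<close>
  define J where "J = S <+> L"
  define x where "x = case_sum f (\<lambda>v. 1 - load F f v)"
  define y where "y = case_sum c (\<lambda>v. - load F c v)"
  have "finite J"
    using fins by (simp add: J_def)
  moreover have "x j > 0" if "j \<in> J" for j
    using that nonneg by (force simp: J_def x_def S_def L_def)
  moreover have "\<exists>j\<in>J. y j < 0"
  proof -
    from neg obtain e where "e \<in> S" "c e < 0"
      by blast
    then show ?thesis
      by (intro bexI[of _ "Inl e"]) (auto simp: J_def y_def)
  qed
  ultimately obtain u where u: "\<And>j. j \<in> J \<Longrightarrow> x j + u * y j \<ge> 0" "\<exists>j\<in>J. x j + u * y j = 0"
    using shift_to_boundary[of J x y] by metis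
  define g where "g = (\<lambda>e. f e + u * c e)"
  have load_g: "load F g v = load F f v + u * load F c v" for v
    unfolding g_def by (rule load_add)
  have g_S: "g e \<ge> 0" if "e \<in> S" for e
    using u(1)[of "Inl e"] that by (simp add: InlI J_def x_def y_def g_def)
  have g_L: "load F g v \<le> 1" if "v \<in> L" for v
    using u(1)[of "Inr v"] that by (simp add: InrI J_def x_def y_def load_g)
  have g_T: "load F g v = load F f v" if "v \<in> T" for v
    using load_c[OF that] by (simp add: load_g)
  have g_out: "g e = 0" if "e \<in> F" "e \<notin> S" for e
    using that by (simp add: g_def c_def S_def)
  define S' L' where "S' = {e \<in> F. g e \<noteq> 0}" and "L' = {v \<in> \<Union>F. load F g v < 1}"
  have S': "S' \<subseteq> S"
    using g_out by (auto simp: S'_def)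
  have L': "L' \<subseteq> L"
    using g_T by (force simp: L'_def L_def T_def)
  obtain j where j: "j \<in> J" "x j + u * y j = 0"
    using u(2) by blast
  have "card S' + card L' < card S + card L"
  proof (cases j)
    case (Inl e)
    then have "e \<in> S" "e \<notin> S'"
      using j by (auto simp: J_def x_def y_def S'_def g_def)
    then have "card S' < card S"
      using S' fins by (intro psubset_card_mono) auto
    moreover have "card L' \<le> card L"
      using L' fins by (intro card_mono) auto
    ultimately show ?thesis
      by simp
  next
    case (Inr v)
    then have "v \<in> L" "v \<notin> L'"
      using j by (auto simp: J_def x_def y_def L'_def load_g)
    then have "card L' < card L"
      using L' fins by (intro psubset_card_mono) auto
    moreover have "card S' \<le> card S"
      using S' fins by (intro card_mono) auto
    ultimately show ?thesis
      by simp
  qed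
  moreover have "defect s F g = defect s F f"
  proof -
    have "sum g F = sum f F"
      using \<open>sum c F = 0\<close> by (simp add: g_def sum.distrib sum_distrib_left[symmetric])
    moreover have "max 0 (load F g v - 1) = max 0 (load F f v - 1)" if "v \<in> \<Union>F" for v
    proof (cases "v \<in> T")
      case True
      then show ?thesis
        by (simp add: g_T)
    next
      case False
      with that have "v \<in> L"
        by (auto simp: T_def L_def)
      with g_L[OF this] show ?thesis
        by (simp add: L_def)
    qed
    then have "(\<Sum>v\<in>\<Union>F. (max 0 (load F g v - 1))\<^sup>2) = (\<Sum>v\<in>\<Union>F. (max 0 (load F f v - 1))\<^sup>2)"
      by (intro sum.cong) (simp_all only:)
    ultimately show ?thesis
      by (simp only: defect_def)
  qed
  moreover have "g e \<ge> 0" if "e \<in> F" for e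
    using that g_S g_out by (cases "e \<in> S") auto
  ultimately show ?thesis
    using that[of g] S' by (simp add: S'_def S_def L'_def L_def)
qed

section \<open>Saturated vertices, light edges and vanishing defect\<close>

lemma card_saturated_le:
  fixes f :: "'a set \<Rightarrow> real"
  assumes fin: "finite F" "finite (\<Union>F)" and nonneg: "\<And>e. e \<in> F \<Longrightarrow> f e \<ge> 0"
    and cover: "\<Union>F \<subseteq> (\<Union>i\<in>{1..r}. A i)"
    and part: "\<And>e i. e \<in> F \<Longrightarrow> i \<in> {1..r} \<Longrightarrow> card (e \<inter> A i) = 1"
    and less: "sum f F < real n"
  shows "card {v \<in> \<Union>F. load F f v \<ge> 1} \<le> r * (n - 1)"
proof -
  define T where "T = {v \<in> \<Union>F. load F f v \<ge> 1}"
  have "card (T \<inter> A i) \<le> n - 1" if i: "i \<in> {1..r}" for i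
  proof -
    have fin': "finite (\<Union>F \<inter> A i)"
      using fin by blast
    have "real (card (T \<inter> A i)) = (\<Sum>v\<in>T \<inter> A i. 1)"
      by simp
    also have "\<dots> \<le> (\<Sum>v\<in>T \<inter> A i. load F f v)"
      by (intro sum_mono) (auto simp: T_def)
    also have "\<dots> \<le> (\<Sum>v\<in>\<Union>F \<inter> A i. load F f v)"
      using fin' nonneg by (intro sum_mono2 load_nonneg) (auto simp: T_def)
    also have "\<dots> = (\<Sum>e\<in>F. f e * real (card (e \<inter> (\<Union>F \<inter> A i))))"
      using sum_weighted_load[OF fin(1) fin', of "\<lambda>_. 1" f] by simp
    also have "\<dots> = sum f F"
    proof (rule sum.cong)
      fix e assume "e \<in> F"
      then have "e \<inter> (\<Union>F \<inter> A i) = e \<inter> A i"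
        by auto
      with part[OF \<open>e \<in> F\<close> i] show "f e * real (card (e \<inter> (\<Union>F \<inter> A i))) = f e"
        by simp
    qed simp
    \<comment> \<open>Strictness matters: an integer below \<open>n\<close> is at most
      \<open>n - 1\<close>, which later leaves one colour free.\<close>
    finally show ?thesis
      using less by linarith
  qed
  then have "(\<Sum>i\<in>{1..r}. card (T \<inter> A i)) \<le> (\<Sum>i\<in>{1..r}. n - 1)"
    by (intro sum_mono)
  moreover have "T = (\<Union>i\<in>{1..r}. T \<inter> A i)"
    using cover by (auto simp: T_def)
  then have "card T \<le> (\<Sum>i\<in>{1..r}. card (T \<inter> A i))"
    using card_UN_le[of "{1..r}" "\<lambda>i. T \<inter> A i"] by simp
  ultimately show ?thesis
    by (simp add: T_def)
qed

text \<open>Weak linear programming duality: if every edge weighed at least \<open>t > 0\<close>,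
  then \<open>w / t\<close> would be a fractional cover of \<open>G\<close> of weight below
  \<open>s\<close>. Keeping \<open>t\<close> as a factor avoids the division.\<close>

lemma light_edge_exists:
  fixes w :: "'a \<Rightarrow> real"
  assumes fin: "finite G" "finite U" and sub: "\<Union>G \<subseteq> U"
    and w: "\<And>v. v \<in> U \<Longrightarrow> w v \<ge> 0" and t: "t \<ge> 0"
    and g: "fractional_matching G g" "fm_size G g \<ge> s"
    and less: "sum w U < t * s"
  shows "\<exists>e\<in>G. sum w e < t"
proof (rule ccontr)
  assume "\<not> ?thesis"
  then have heavy: "sum w e \<ge> t" if "e \<in> G" for e
    using that by force
  have "t * s \<le> t * (\<Sum>e\<in>G. g e)"
    using g(2) t by (intro mult_left_mono) (auto simp: fm_size_def)
  also have "\<dots> = (\<Sum>e\<in>G. g e * t)"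
    by (simp add: sum_distrib_left mult.commute)
  also have "\<dots> \<le> (\<Sum>e\<in>G. g e * sum w (e \<inter> U))"
  proof (rule sum_mono)
    fix e assume "e \<in> G"
    moreover from this have "e \<inter> U = e"
      using sub by auto
    ultimately show "g e * t \<le> g e * sum w (e \<inter> U)"
      using heavy g(1) by (auto simp: fractional_matching_def intro: mult_left_mono)
  qed
  also have "\<dots> = (\<Sum>v\<in>U. w v * load G g v)"
    by (rule sum_weighted_load[OF fin, symmetric])
  also have "\<dots> \<le> (\<Sum>v\<in>U. w v * 1)"
    using w g(1) by (intro sum_mono mult_left_mono) (auto simp: load_def fractional_matching_def)
  finally show False
    using less by simp
qed

text \<open>The defect is a sum of squares, so each term vanishes. Deleting edges of weight
  \<open>0\<close> changes neither loads nor size, and it is the support that must be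
  rainbow.\<close>

lemma fractional_matching_of_zero_defect:
  assumes fin: "finite F" "finite (\<Union>F)" and nonneg: "\<And>e. e \<in> F \<Longrightarrow> f e \<ge> 0"
    and zero: "defect s F f = 0"
  defines "S \<equiv> {e \<in> F. f e \<noteq> 0}"
  shows "fractional_matching S f" "fm_size S f = s"
proof -
  have sq: "(\<Sum>v\<in>\<Union>F. (max 0 (load F f v - 1))\<^sup>2) = 0" "(s - sum f F)\<^sup>2 = 0"
    using zero add_nonneg_eq_0_iff[of "\<Sum>v\<in>\<Union>F. (max 0 (load F f v - 1))\<^sup>2" "(s - sum f F)\<^sup>2"]
    by (auto simp: defect_def sum_nonneg)
  have le: "load F f v \<le> 1" if "v \<in> \<Union>F" for v
  proof -
    have "(max 0 (load F f v - 1))\<^sup>2 = 0"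
      using sum_nonneg_0[OF fin(2) _ sq(1) that] by simp
    then show ?thesis
      by (simp add: max_def split: if_splits)
  qed
  have "(\<Sum>e | e \<in> S \<and> v \<in> e. f e) \<le> 1" for v
  proof -
    have "(\<Sum>e | e \<in> S \<and> v \<in> e. f e) = load F f v"
      unfolding load_def using fin by (intro sum.mono_neutral_left) (auto simp: S_def)
    also have "\<dots> \<le> 1"
    proof (cases "v \<in> \<Union>F")
      case True
      then show ?thesis
        by (rule le)
    next
      case False
      then have "{e \<in> F. v \<in> e} = {}"
        by auto
      then show ?thesis
        by (simp only: load_def) simp
    qed
    finally show ?thesis .
  qed
  then show "fractional_matching S f"
    using nonneg by (simp add: fractional_matching_def S_def)
  have "fm_size S f = sum f F"
    unfolding fm_size_def using fin by (intro sum.mono_neutral_left) (auto simp: S_def)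
  with sq(2) show "fm_size S f = s"
    by simp
qed

section \<open>The optimisation argument for an abstract independence system\<close>

text \<open>The colours are abstracted into a family \<open>\<I>\<close> closed under subsets;
  \<open>augment\<close> expresses that a small independent set leaves a colour free, any edge of
  which can be added.\<close>

lemma independent_fractional_matching:
  fixes F :: "'a set set" and n r :: nat
  assumes fin: "finite F" "finite (\<Union>F)" and n: "n \<ge> 1"
    and cover: "\<Union>F \<subseteq> (\<Union>i\<in>{1..r}. A i)"
    and part: "\<And>e i. e \<in> F \<Longrightarrow> i \<in> {1..r} \<Longrightarrow> card (e \<inter> A i) = 1"
    and empty: "{} \<in> \<I>" and down: "\<And>S T. S \<in> \<I> \<Longrightarrow> T \<subseteq> S \<Longrightarrow> T \<in> \<I>"
    and augment: "\<And>S. S \<in> \<I> \<Longrightarrow> S \<subseteq> F \<Longrightarrow> card S \<le> r * (n - 1) \<Longrightarrow>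
      \<exists>G\<subseteq>F. (\<forall>e\<in>G. insert e S \<in> \<I>) \<and> (\<exists>g. fractional_matching G g \<and> fm_size G g \<ge> real n)"
  obtains S f where "S \<in> \<I>" "S \<subseteq> F" "fractional_matching S f" "fm_size S f = real n"
proof -
  define supp where "supp f = {e \<in> F. f e \<noteq> 0}" for f :: "'a set \<Rightarrow> real"
  define admissible where "admissible f \<longleftrightarrow> (\<forall>e\<in>F. f e \<ge> 0) \<and> supp f \<in> \<I>" for f
  define \<Phi> where "\<Phi> = defect (real n) F"
  define minimal where "minimal f \<longleftrightarrow> admissible f \<and> (\<forall>g. admissible g \<longrightarrow> \<Phi> f \<le> \<Phi> g)" for f
  define \<mu> where "\<mu> f = card (supp f) + card {v \<in> \<Union>F. load F f v < 1}" for f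
  obtain f0 where "minimal f0"
  proof (rule defect_minimiser[of F "real n" \<I>, OF fin(1) _ empty down])
    fix f
    assume "\<And>e. e \<in> F \<Longrightarrow> f e \<ge> 0" "{e \<in> F. f e \<noteq> 0} \<in> \<I>"
      "\<And>g. (\<And>e. e \<in> F \<Longrightarrow> g e \<ge> 0) \<Longrightarrow> {e \<in> F. g e \<noteq> 0} \<in> \<I>
        \<Longrightarrow> defect (real n) F f \<le> defect (real n) F g"
    then have "minimal f"
      by (simp add: minimal_def admissible_def supp_def \<Phi>_def)
    then show thesis
      by (rule that)
  qed auto
  \<comment> \<open>Among the minimisers of \<open>\<Phi>\<close>, one with least
    \<open>\<mu>\<close> is taken. Since \<open>reduce_support\<close> keeps the defect and lowers
    \<open>\<mu>\<close>, its hypotheses must fail for this \<open>f\<close>.\<close>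
  then obtain f where f: "minimal f" "\<And>g. minimal g \<Longrightarrow> \<mu> f \<le> \<mu> g"
    using ex_has_least_nat[of minimal f0 \<mu>] by blast
  have nonneg: "f e \<ge> 0" if "e \<in> F" for e
    using f(1) that by (simp add: minimal_def admissible_def)
  have indep: "supp f \<in> \<I>"
    using f(1) by (simp add: minimal_def admissible_def)
  have least: "\<Phi> f \<le> \<Phi> g" if "admissible g" for g
    using f(1) that by (simp add: minimal_def)
  define w where "w = (\<lambda>v. max 0 (load F f v - 1))"
  define t where "t = real n - sum f F"
  have heavy: "sum w e \<ge> t" if e: "e \<in> F" and ins: "insert e (supp f) \<in> \<I>" for e
  proof (rule ccontr)
    assume "\<not> ?thesis"
    then have "sum w e < t"
      by simp
    from defect_decreases_up[OF fin e this[unfolded w_def t_def]]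
    obtain u where u: "u > 0" "\<Phi> (f(e := f e + u)) < \<Phi> f"
      unfolding \<Phi>_def by blast
    have "supp (f(e := f e + u)) \<subseteq> insert e (supp f)"
      by (auto simp: supp_def)
    then have "admissible (f(e := f e + u))"
      using down[OF ins] nonneg e u(1) by (auto simp: admissible_def add_nonneg_pos less_imp_le)
    with least u(2) show False
      by force
  qed
  \<comment> \<open>On the support the weight can be moved in both directions without leaving
    \<open>\<I>\<close>, which forces equality.\<close>
  have tight: "sum w e = t" if e: "e \<in> F" "f e \<noteq> 0" for e
  proof (rule antisym)
    show "sum w e \<le> t"
    proof (rule ccontr)
      assume "\<not> ?thesis"
      then have "t < sum w e"
        by simp
      moreover have "f e > 0"
        using nonneg e by (simp add: less_le)
      ultimately obtain u where u: "u \<le> f e" "\<Phi> (f(e := f e - u)) < \<Phi> f"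
        using defect_decreases_down[OF fin e(1), of f "real n"]
        unfolding w_def t_def \<Phi>_def by blast
      have "supp (f(e := f e - u)) \<subseteq> supp f"
        using e by (auto simp: supp_def)
      then have "admissible (f(e := f e - u))"
        using down[OF indep] nonneg u(1) by (auto simp: admissible_def)
      with least u(2) show False
        by force
    qed
    have "insert e (supp f) = supp f"
      using e by (auto simp: supp_def)
    with heavy[OF e(1)] indep show "t \<le> sum w e"
      by simp
  qed
  have "\<Phi> f = 0"
  proof (rule ccontr)
    assume "\<Phi> f \<noteq> 0"
    moreover have "\<Phi> f \<ge> 0"
      by (simp add: \<Phi>_def defect_def sum_nonneg)
    moreover have "sum w (\<Union>F) + \<Phi> f = t * real n"
      using defect_duality[OF fin, of f "real n"] tight unfolding w_def t_def \<Phi>_def by blast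
    moreover have "sum w (\<Union>F) \<ge> 0"
      by (simp add: w_def sum_nonneg)
    ultimately have less: "sum w (\<Union>F) < t * real n" and "t * real n > 0"
      by linarith+
    then have t: "t > 0"
      using n by (simp add: zero_less_mult_iff)
    have "card (supp f) \<le> card {v \<in> \<Union>F. load F f v \<ge> 1}"
    proof (rule ccontr)
      assume "\<not> ?thesis"
      then have "card {v \<in> \<Union>F. load F f v \<ge> 1} < card {e \<in> F. f e \<noteq> 0}"
        by (simp add: supp_def)
      from reduce_support[OF fin nonneg tight[unfolded w_def] less_imp_neq[OF t, symmetric] this,
          of "real n"]
      obtain g where g: "\<forall>e\<in>F. g e \<ge> 0" "supp g \<subseteq> supp f" "\<Phi> g = \<Phi> f" "\<mu> g < \<mu> f"
        unfolding supp_def \<Phi>_def \<mu>_def by blast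
      have "minimal g"
        using g(1,3) down[OF indep g(2)] least by (simp add: minimal_def admissible_def)
      with f(2) g(4) show False
        by force
    qed
    also have "\<dots> \<le> r * (n - 1)"
      using t by (intro card_saturated_le[OF fin nonneg cover part]) (auto simp: t_def)
    finally have "card (supp f) \<le> r * (n - 1)" .
    moreover have "supp f \<subseteq> F"
      by (auto simp: supp_def)
    ultimately obtain G g where G: "G \<subseteq> F" "\<And>e. e \<in> G \<Longrightarrow> insert e (supp f) \<in> \<I>"
      and g: "fractional_matching G g" "fm_size G g \<ge> real n"
      using augment[OF indep] by blast
    \<comment> \<open>\<open>G\<close> has a fractional matching of size at least \<open>n\<close>,
      too large for \<open>w / t\<close> to cover \<open>G\<close>; the uncovered edge contradicts
      \<open>heavy\<close>.\<close>
    have "\<exists>e\<in>G. sum w e < t"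
      using G(1) t fin
      by (intro light_edge_exists[OF _ fin(2) _ _ _ g less]) (auto simp: w_def intro: finite_subset)
    with heavy G show False
      by force
  qed
  then have "fractional_matching (supp f) f" "fm_size (supp f) f = real n"
    unfolding \<Phi>_def supp_def
    using fractional_matching_of_zero_defect[OF fin nonneg, where s = "real n"] by simp_all
  moreover have "supp f \<subseteq> F"
    by (auto simp: supp_def)
  ultimately show ?thesis
    using that indep by blast
qed

section \<open>Rainbow sets as an independence system\<close>

theorem theorem7:
  fixes r n :: nat and V :: "'a set" and H :: "'a set set" and E :: "nat \<Rightarrow> 'a set set"
  assumes "r \<ge> 2" and "n \<ge> 1"
    and "r_partite r V H"
    and "\<And>i. i \<in> {1..r * n - r + 1} \<Longrightarrow> E i \<subseteq> H"
    and "\<And>i. i \<in> {1..r * n - r + 1} \<Longrightarrow> finite (E i)"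
    and "\<And>i. i \<in> {1..r * n - r + 1} \<Longrightarrow> fractional_matching_number (E i) \<ge> real n"
  shows "rainbow_fractional_matching (r * n - r + 1) E (real n)"
proof -
  define m where "m = r * n - r + 1"
  define F where "F = (\<Union>i\<in>{1..m}. E i)"
  \<comment> \<open>These are the partial transversals of the family: sets whose edges admit
    distinct colours.\<close>
  define \<I> where
    "\<I> = {S. \<exists>c :: 'a set \<Rightarrow> nat. inj_on c S \<and> (\<forall>e\<in>S. c e \<in> {1..m} \<and> e \<in> E (c e))}"
  obtain A where cover: "(\<Union>i\<in>{1..r}. A i) = V"
    and edges: "\<And>e. e \<in> H \<Longrightarrow> e \<subseteq> V" "\<And>e i. e \<in> H \<Longrightarrow> i \<in> {1..r} \<Longrightarrow> card (e \<inter> A i) = 1"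
    using assms(3) unfolding r_partite_def by metis
  have "F \<subseteq> H"
    using assms(4) unfolding F_def m_def by blast
  have "finite F"
    using assms(5) by (simp add: F_def m_def)
  \<comment> \<open>\<open>card\<close> of an infinite set is \<open>0\<close>, so the value
    \<open>1\<close> makes the trace of \<open>e\<close> on each part finite.\<close>
  have "finite e" if "e \<in> H" for e
  proof -
    have "e = (\<Union>i\<in>{1..r}. e \<inter> A i)"
      using edges(1)[OF that] cover by blast
    moreover have "finite (e \<inter> A i)" if "i \<in> {1..r}" for i
      using edges(2)[OF \<open>e \<in> H\<close> that] by (intro card_ge_0_finite) simp
    ultimately show ?thesis
      by (metis finite_UN finite_atLeastAtMost)
  qed
  with \<open>F \<subseteq> H\<close> \<open>finite F\<close> have "finite (\<Union>F)"
    by blast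
  \<comment> \<open>An empty edge could carry arbitrarily large weight; its absence ensures that the
    fractional matching number is attained.\<close>
  have "{} \<notin> H"
    using edges(2)[of "{}" 1] assms(1) by auto
  have empty: "{} \<in> \<I>"
    by (simp add: \<I>_def)
  have down: "T \<in> \<I>" if "S \<in> \<I>" "T \<subseteq> S" for S T
    using that unfolding \<I>_def by (blast intro: inj_on_subset)
  have augment: "\<exists>G\<subseteq>F. (\<forall>e\<in>G. insert e S \<in> \<I>)
      \<and> (\<exists>g. fractional_matching G g \<and> fm_size G g \<ge> real n)"
    if "S \<in> \<I>" "S \<subseteq> F" "card S \<le> r * (n - 1)" for S
  proof -
    obtain c where c: "inj_on c S" "\<forall>e\<in>S. c e \<in> {1..m} \<and> e \<in> E (c e)"
      using \<open>S \<in> \<I>\<close> unfolding \<I>_def by blast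
    have "finite S"
      using that(2) \<open>finite F\<close> by (rule finite_subset)
    have "card (c ` S) \<le> r * (n - 1)"
      using that(3) card_image_le[OF \<open>finite S\<close>, of c] by linarith
    also have "\<dots> < card {1..m}"
      by (simp add: m_def diff_mult_distrib2)
    finally obtain i where i: "i \<in> {1..m}" "i \<notin> c ` S"
      using card_mono[of "c ` S" "{1..m}"] \<open>finite S\<close> by (meson finite_imageI not_le subsetI)
    have "insert e S \<in> \<I>" if "e \<in> E i" for e
    proof (cases "e \<in> S")
      case True
      with \<open>S \<in> \<I>\<close> show ?thesis
        by (simp add: insert_absorb)
    next
      case False
      then have "inj_on (c(e := i)) (insert e S)"
        using c(1) i(2) by (auto simp: inj_on_def)
      moreover have "\<forall>x\<in>insert e S. (c(e := i)) x \<in> {1..m} \<and> x \<in> E ((c(e := i)) x)"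
        using c(2) i(1) that by auto
      ultimately show ?thesis
        unfolding \<I>_def by blast
    qed
    moreover have "E i \<subseteq> F"
      using i(1) by (auto simp: F_def)
    moreover obtain g where "fractional_matching (E i) g"
      "fm_size (E i) g = fractional_matching_number (E i)"
      using fractional_matching_number_attained[of "E i"] assms(4,5) i(1) \<open>{} \<notin> H\<close>
      unfolding m_def by (metis subsetD)
    ultimately show ?thesis
      using assms(6)[of i] i(1) unfolding m_def by metis
  qed
  have cover': "\<Union>F \<subseteq> (\<Union>i\<in>{1..r}. A i)"
    using \<open>F \<subseteq> H\<close> edges(1) unfolding cover by blast
  have part: "card (e \<inter> A i) = 1" if "e \<in> F" "i \<in> {1..r}" for e i
    using edges(2) \<open>F \<subseteq> H\<close> that by blast
  obtain S f where S: "S \<in> \<I>" "S \<subseteq> F"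
    and f: "fractional_matching S f" "fm_size S f = real n"
    by (rule independent_fractional_matching[OF \<open>finite F\<close> \<open>finite (\<Union>F)\<close> assms(2)
      cover' part empty down augment])
  obtain c where c: "inj_on c S" "\<forall>e\<in>S. c e \<in> {1..m} \<and> e \<in> E (c e)"
    using S(1) unfolding \<I>_def by blast
  \<comment> \<open>Enumerating \<open>S\<close> turns the colouring into the required indices:
    \<open>\<sigma>\<close> is \<open>c \<circ> h\<close>, and injectivity of \<open>c\<close> keeps
    them distinct.\<close>
  obtain h where h: "bij_betw h {1..card S} S"
    using ex_bij_betw_nat_finite_1 finite_subset[OF S(2) \<open>finite F\<close>] by blast
  then have h': "h ` {1..card S} = S" "inj_on h {1..card S}"
    by (auto simp: bij_betw_def)
  have "(c \<circ> h) ` {1..card S} \<subseteq> {1..m}" "\<forall>j\<in>{1..card S}. h j \<in> E ((c \<circ> h) j)"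
    using c(2) h'(1) by fastforce+
  moreover have "inj_on (c \<circ> h) {1..card S}"
    using c(1) h' by (simp add: comp_inj_on)
  ultimately show ?thesis
    using f h'(1) unfolding rainbow_fractional_matching_def m_def by metis
qed

end
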